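(* The $q$-shuffle product $\sqcup\!\sqcup$ on $\mathbb Q.W$ is commutative and associative. Moreover, for any $v,u\in W$, $$\bar{\mathfrak z}_q^{\sqcup\!\sqcup}(v)\;\bar{\mathfrak z}_q^{\sqcup\!\sqcup}(u)=\bar{\mathfrak z}_q^{\sqcup\!\sqcup}(v\sqcup\!\sqcup u).$$
   Context: Modified $q$-multiple zeta values: for $k\ge1$ and $n_1,\dots,n_k\in\mathbb Z$, $$\bar{\mathfrak z}_q(n_1,\dots,n_k)=\sum_{m_1>\cdots>m_k>0}\frac{q^{m_1}}{(1-q^{m_1})^{n_1}\cdots(1-q^{m_k})^{n_k}},$$ an element of $q\,\mathbb Q[[q]]$ (the series also converges for every complex $q$ with $|q|<1$). $W$ is the set of words on the alphabet $\{d,y,p\}$ which are empty or end with $y$, subject to $dp=pd=\mathbf 1$, where $\mathbf 1$ is the empty word; write $p^{-1}=d$. Every non-empty $v\in W$ is written uniquely as $v=p^{n_1}y\cdots p^{n_k}y$ with $k>0$, $n_1,\dots,n_k\in\mathbb Z$, and its length is $\ell(v)=k+|n_1|+\cdots+|n_k|$. $\mathbb Q.W$ is the $\mathbb Q$-vector space with basis $W$. The $q$-shuffle product $\sqcup\!\sqcup$ is the bilinear product on $\mathbb Q.W$ defined recursively with respect to the length of words by $\mathbf 1\sqcup\!\sqcup v=v\sqcup\!\sqcup\mathbf 1=v$ and \begin{align*} (yv)\sqcup\!\sqcup u=v\sqcup\!\sqcup(yu)&=y(v\sqcup\!\sqcup u),\\ pv\sqcup\!\sqcup pu&=p(v\sqcup\!\sqcup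 pu)+p(pv\sqcup\!\sqcup u)-p(v\sqcup\!\sqcup u),\\ dv\sqcup\!\sqcup du&=v\sqcup\!\sqcup du+dv\sqcup\!\sqcup u-d(v\sqcup\!\sqcup u),\\ dv\sqcup\!\sqcup pu=pu\sqcup\!\sqcup dv&=d(v\sqcup\!\sqcup pu)+dv\sqcup\!\sqcup u-v\sqcup\!\sqcup u \end{align*} for words $v,u\in W$ (non-empty in the last three rules, so that $pv,pu,dv,du\in W$). Left concatenation by $y,p,d$ is extended linearly. The $\mathbb Q$-linear map $\bar{\mathfrak z}_q^{\sqcup\!\sqcup}:\mathbb Q.W\to\mathbb Q[[q]]$ is given by $\bar{\mathfrak z}_q^{\sqcup\!\sqcup}(p^{n_1}y\cdots p^{n_k}y)=\bar{\mathfrak z}_q(n_1,\dots,n_k)$ and $\bar{\mathfrak z}_q^{\sqcup\!\sqcup}(\mathbf 1)=1$. *)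

theory Defs
  imports "HOL-Analysis.Analysis" "HOL-Library.Poly_Mapping"
begin

text \<open>
  A word of \<open>W\<close> is represented by its exponents: the list \<open>[n\<^sub>1, \<dots>, n\<^sub>k]\<close> stands for
  \<open>p\<^bsup>n\<^sub>1\<^esup> y \<cdots> p\<^bsup>n\<^sub>k\<^esup> y\<close> with \<open>p\<^bsup>-1\<^esup> = d\<close>, and \<open>[]\<close> for the empty word. Every class of words modulo
  \<open>dp = pd = 1\<close> has exactly one such form.
\<close>

type_synonym qword = "int list"

definition qword_length :: "qword \<Rightarrow> nat" where
  "qword_length v = length v + (\<Sum>n\<leftarrow>v. nat \<bar>n\<bar>)"

definition ycat :: "qword \<Rightarrow> qword" where
  "ycat v = 0 # v"

text \<open>
  The words \<open>p\<close> and \<open>d\<close> do not belong to \<open>W\<close>; the values at \<open>[]\<close> are junk. They are never used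
  below, since the product of two non-empty words has no component on the empty word.
\<close>

fun pcat :: "qword \<Rightarrow> qword" where
  "pcat [] = []"
| "pcat (n # v) = (n + 1) # v"

fun dcat :: "qword \<Rightarrow> qword" where
  "dcat [] = []"
| "dcat (n # v) = (n - 1) # v"

type_synonym qwords = "qword \<Rightarrow>\<^sub>0 rat"

abbreviation wd :: "qword \<Rightarrow> qwords" where
  "wd v \<equiv> Poly_Mapping.single v 1"

definition scaleW :: "rat \<Rightarrow> qwords \<Rightarrow> qwords" where
  "scaleW c x = Poly_Mapping.map (\<lambda>a. c * a) x"

definition linW :: "(qword \<Rightarrow> qword) \<Rightarrow> qwords \<Rightarrow> qwords" where
  "linW f x = (\<Sum>v\<in>Poly_Mapping.keys x. Poly_Mapping.single (f v) (Poly_Mapping.lookup x v))"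

text \<open>
  Each clause is the instance of a defining rule of the product that is applicable to the
  normal forms of the two factors, so that the recursion decreases the sum of the lengths. That
  the rules then hold for arbitrary words is shown in the lemmas \<open>qsh_word_y_left\<close> to
  \<open>qsh_word_pd\<close> below.
\<close>

function qsh_word :: "qword \<Rightarrow> qword \<Rightarrow> qwords" where
  "qsh_word [] u = wd u"
| "qsh_word (a # v) [] = wd (a # v)"
| "qsh_word (a # v) (b # u) =
    (if a = 0 then linW ycat (qsh_word v (b # u))
     else if b = 0 then linW ycat (qsh_word (a # v) u)
     else if a > 0 \<and> b > 0 then
       linW pcat (qsh_word ((a - 1) # v) (b # u)) + linW pcat (qsh_word (a # v) ((b - 1) # u))
         - linW pcat (qsh_word ((a - 1) # v) ((b - 1) # u))
     else if a < 0 \<and> b < 0 then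
       qsh_word ((a + 1) # v) (b # u) + qsh_word (a # v) ((b + 1) # u)
         - linW dcat (qsh_word ((a + 1) # v) ((b + 1) # u))
     else if a < 0 then
       linW dcat (qsh_word ((a + 1) # v) (b # u)) + qsh_word (a # v) ((b - 1) # u)
         - qsh_word ((a + 1) # v) ((b - 1) # u)
     else
       linW dcat (qsh_word ((b + 1) # u) (a # v)) + qsh_word (b # u) ((a - 1) # v)
         - qsh_word ((b + 1) # u) ((a - 1) # v))"
  by pat_completeness auto
termination
  by (relation "Wellfounded.measure (\<lambda>(v, u). qword_length v + qword_length u)") (auto simp: qword_length_def)

declare qsh_word.simps(3) [simp del]

definition qsh :: "qwords \<Rightarrow> qwords \<Rightarrow> qwords" (infixl \<open>\<squnion>\<squnion>\<close> 70) where
  "x \<squnion>\<squnion> y = (\<Sum>v\<in>Poly_Mapping.keys x. \<Sum>u\<in>Poly_Mapping.keys y.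
     scaleW (Poly_Mapping.lookup x v * Poly_Mapping.lookup y u) (qsh_word v u))"

lemma linW_superset:
  assumes "finite A" "Poly_Mapping.keys x \<subseteq> A"
  shows "linW f x = (\<Sum>v\<in>A. Poly_Mapping.single (f v) (Poly_Mapping.lookup x v))"
  unfolding linW_def using assms
  by (intro sum.mono_neutral_left) (auto simp: in_keys_iff)

lemma linW_add: "linW f (x + y) = linW f x + linW f y"
proof -
  let ?A = "Poly_Mapping.keys x \<union> Poly_Mapping.keys y"
  have "Poly_Mapping.keys (x + y) \<subseteq> ?A" by (rule Poly_Mapping.keys_add)
  then show ?thesis
    by (subst (1 2 3) linW_superset[where A = ?A])
      (auto simp: lookup_add single_add sum.distrib)
qed

lemma linW_diff: "linW f (x - y) = linW f x - linW f y"
  using linW_add[of f "x - y" y] by (simp add: algebra_simps)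

lemma linW_single [simp]: "linW f (Poly_Mapping.single v c) = Poly_Mapping.single (f v) c"
  by (cases "c = 0") (auto simp: linW_def)

lemma linW_linW: "linW f (linW g x) = linW (f \<circ> g) x"
proof -
  have "linW f (sum h A) = (\<Sum>i\<in>A. linW f (h i))" if "finite A" for h and A :: "qword set"
    using that by induction (auto simp: linW_add, simp add: linW_def)
  then show ?thesis
    unfolding linW_def[of g x] by (simp add: linW_def[of "f \<circ> g"])
qed

lemma linW_id: "linW id x = x"
  by (rule poly_mapping_eqI)
    (auto simp: linW_def lookup_sum lookup_single when_def sum.delta' in_keys_iff)

lemma linW_pcat_dcat [simp]: "linW pcat (linW dcat x) = x"
proof -
  have "pcat \<circ> dcat = id" by (rule ext, case_tac x) auto
  then show ?thesis by (simp add: linW_linW linW_id)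
qed

lemma linW_dcat_pcat [simp]: "linW dcat (linW pcat x) = x"
proof -
  have "dcat \<circ> pcat = id" by (rule ext, case_tac x) auto
  then show ?thesis by (simp add: linW_linW linW_id)
qed

lemma qsh_word_Nil_right: "qsh_word v [] = wd v"
  by (cases v) auto

lemma qsh_word_y_left: "qsh_word (ycat v) u = linW ycat (qsh_word v u)"
  by (cases u) (auto simp: ycat_def qsh_word_Nil_right qsh_word.simps(3))

lemma qsh_word_y_right: "qsh_word v (ycat u) = linW ycat (qsh_word v u)"
proof (induction v)
  case (Cons a v)
  have "qsh_word v (0 # u) = linW ycat (qsh_word v u)"
    using Cons by (metis ycat_def)
  moreover have "linW ycat (qsh_word v u) = qsh_word (a # v) u" if "a = 0"
    using that qsh_word_y_left[of v u] by (simp add: ycat_def)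
  ultimately have "qsh_word (a # v) (0 # u) = linW ycat (qsh_word (a # v) u)"
    using qsh_word.simps(3)[of a v 0 u] by auto
  then show ?case by (metis ycat_def)
qed (simp add: ycat_def)

lemma qsh_word_commute: "qsh_word v u = qsh_word u v"
proof (induction v u rule: qsh_word.induct)
  case (3 a v b u)
  show ?case
  proof (cases "a = 0 \<or> b = 0")
    case True
    then show ?thesis
      using 3(1,2) qsh_word_y_left[of v "b # u"] qsh_word_y_right[of "b # u" v]
        qsh_word_y_left[of u "a # v"] qsh_word_y_right[of "a # v" u]
      by (cases "a = 0") (auto simp: ycat_def)
  next
    case False
    then consider "a > 0" "b > 0" | "a < 0" "b < 0" | "a < 0" "b > 0" | "a > 0" "b < 0"
      by linarith
    then show ?thesis
    proof cases
      case 1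
      then show ?thesis
        using 3(3-5) qsh_word.simps(3)[of a v b u] qsh_word.simps(3)[of b u a v] by simp
    next
      case 2
      then show ?thesis
        using 3(6-8) qsh_word.simps(3)[of a v b u] qsh_word.simps(3)[of b u a v] by simp
    next
      case 3
      then show ?thesis
        using qsh_word.simps(3)[of a v b u] qsh_word.simps(3)[of b u a v] by simp
    next
      case 4
      then show ?thesis
        using qsh_word.simps(3)[of a v b u] qsh_word.simps(3)[of b u a v] by simp
    qed
  qed
qed (simp_all add: qsh_word_Nil_right)

lemma qsh_word_pp:
  assumes "v \<noteq> []" "u \<noteq> []"
  shows "qsh_word (pcat v) (pcat u) =
    linW pcat (qsh_word v (pcat u)) + linW pcat (qsh_word (pcat v) u) - linW pcat (qsh_word v u)"
proof -
  obtain a v' b u' where [simp]: "v = a # v'" "u = b # u'"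
    using assms by (meson neq_Nil_conv)
  have mixed: "qsh_word ((a + 1) # v) ((b + 1) # u) =
      linW pcat (qsh_word (a # v) ((b + 1) # u)) + linW pcat (qsh_word ((a + 1) # v) (b # u))
        - linW pcat (qsh_word (a # v) (b # u))"
    if "a < 0" "b \<ge> 0" for a b v u
  proof -
    have "qsh_word (a # v) ((b + 1) # u) = linW dcat (qsh_word ((a + 1) # v) ((b + 1) # u))
        + qsh_word (a # v) (b # u) - qsh_word ((a + 1) # v) (b # u)"
      using that by (subst qsh_word.simps(3)) simp
    then show ?thesis by (simp add: linW_add linW_diff)
  qed
  consider "a \<ge> 0" "b \<ge> 0" | "a < 0" "b < 0" | "a < 0" "b \<ge> 0" | "a \<ge> 0" "b < 0"
    by linarith
  then show ?thesis
  proof cases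
    case 1
    then show ?thesis
      by simp (subst qsh_word.simps(3), simp)
  next
    case 2
    then have "qsh_word (a # v') (b # u') =
        qsh_word ((a + 1) # v') (b # u') + qsh_word (a # v') ((b + 1) # u')
          - linW dcat (qsh_word ((a + 1) # v') ((b + 1) # u'))"
      by (subst qsh_word.simps(3)) simp
    then show ?thesis by (simp add: linW_add linW_diff)
  next
    case 3
    then show ?thesis using mixed[of a b v' u'] by simp
  next
    case 4
    then show ?thesis using mixed[of b a u' v']
      by (simp add: qsh_word_commute[of "b # u'"] qsh_word_commute[of "(b + 1) # u'"]
         )
  qed
qed

lemma pcat_dcat [simp]: "pcat (dcat v) = v" "dcat (pcat v) = v"
  by (cases v; simp)+

lemma dcat_eq_Nil [simp]: "dcat v = [] \<longleftrightarrow> v = []"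
  by (cases v) auto

lemma qsh_word_dd:
  assumes "v \<noteq> []" "u \<noteq> []"
  shows "qsh_word (dcat v) (dcat u) =
    qsh_word v (dcat u) + qsh_word (dcat v) u - linW dcat (qsh_word v u)"
proof -
  have "linW dcat (qsh_word v u) =
    qsh_word (dcat v) u + qsh_word v (dcat u) - qsh_word (dcat v) (dcat u)"
    using qsh_word_pp[of "dcat v" "dcat u"] assms by (simp add: linW_add linW_diff)
  then show ?thesis by simp
qed

lemma qsh_word_dp:
  assumes "v \<noteq> []" "u \<noteq> []"
  shows "qsh_word (dcat v) (pcat u) =
    linW dcat (qsh_word v (pcat u)) + qsh_word (dcat v) u - qsh_word v u"
proof -
  have "linW dcat (qsh_word v (pcat u)) =
    qsh_word (dcat v) (pcat u) + qsh_word v u - qsh_word (dcat v) u"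
    using qsh_word_pp[of "dcat v" u] assms by (simp add: linW_add linW_diff)
  then show ?thesis by simp
qed

lemma qsh_word_pd:
  assumes "v \<noteq> []" "u \<noteq> []"
  shows "qsh_word (pcat u) (dcat v) =
    linW dcat (qsh_word v (pcat u)) + qsh_word (dcat v) u - qsh_word v u"
  using qsh_word_dp[OF assms] by (simp add: qsh_word_commute)

lemma scaleW_1 [simp]: "scaleW 1 x = x"
  by (rule poly_mapping_eqI) (simp add: scaleW_def Poly_Mapping.map.rep_eq when_def)

lemma qsh_wd [simp]: "wd v \<squnion>\<squnion> wd u = qsh_word v u"
  by (simp add: qsh_def)

definition zq_indices :: "nat \<Rightarrow> nat list set" where
  "zq_indices k = {ms. length ms = k \<and> sorted_wrt (>) ms \<and> (\<forall>m\<in>set ms. m > 0)}"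

definition zq_term :: "int list \<Rightarrow> nat list \<Rightarrow> rat fps" where
  "zq_term ns ms =
     fps_X ^ hd ms / (\<Prod>i<length ns. (1 - fps_X ^ (ms ! i)) powi (ns ! i))"

text \<open>
  Intended for non-empty \<open>ns\<close>. The infinite sum is taken in the usual topology of formal power
  series; \<open>zq_has_sum\<close> below shows that it exists.
\<close>

definition zq :: "int list \<Rightarrow> rat fps" where
  "zq ns = (\<Sum>\<^sub>\<infinity>ms\<in>zq_indices (length ns). zq_term ns ms)"

definition zq_word :: "qword \<Rightarrow> rat fps" where
  "zq_word v = (if v = [] then 1 else zq v)"

definition zq_sh :: "qwords \<Rightarrow> rat fps" where
  "zq_sh x = (\<Sum>v\<in>Poly_Mapping.keys x. fps_const (Poly_Mapping.lookup x v) * zq_word v)"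

lemma zq_sh_wd [simp]: "zq_sh (wd v) = zq_word v"
  by (simp add: zq_sh_def)

lemma finite_zq_indices_le:
  "finite {ms \<in> zq_indices k. hd ms \<le> N}"
proof (rule finite_subset)
  show "{ms \<in> zq_indices k. hd ms \<le> N} \<subseteq> {ms. set ms \<subseteq> {..N} \<and> length ms = k}"
  proof safe
    fix ms m assume ms: "ms \<in> zq_indices k" "hd ms \<le> N" "m \<in> set ms"
    then show "m \<le> N"
      by (cases ms) (auto simp: zq_indices_def)
  qed (auto simp: zq_indices_def)
qed (rule finite_lists_length_eq, simp)

lemma zq_term_nth_0:
  assumes "ms \<in> zq_indices (length ns)" "N < hd ms"
  shows "fps_nth (zq_term ns ms) N = 0"
proof -
  have unit: "fps_nth ((1 - fps_X ^ (ms ! i)) powi (ns ! i)) 0 \<noteq> (0 :: rat)" if "i < length ns" for i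
  proof -
    have "ms ! i > 0" using assms(1) that by (auto simp: zq_indices_def)
    then have "fps_nth (1 - fps_X ^ (ms ! i) :: rat fps) 0 = 1" by simp
    then show ?thesis by (simp add: power_int_def fps_power_zeroth del: fps_sub_nth)
  qed
  have "fps_nth (\<Prod>i<n. (1 - fps_X ^ (ms ! i)) powi (ns ! i)) 0 \<noteq> (0 :: rat)"
    if "n \<le> length ns" for n
    using that
  proof (induction n)
    case (Suc n)
    then show ?case using unit[of n] by simp
  qed simp
  then have "zq_term ns ms =
      fps_X ^ hd ms * inverse (\<Prod>i<length ns. (1 - fps_X ^ (ms ! i)) powi (ns ! i))"
    unfolding zq_term_def by (intro fps_divide_unit) simp
  then show ?thesis using assms(2) by (simp add: fps_X_power_mult_nth)
qed

lemma zq_has_sum: "(zq_term ns has_sum zq ns) (zq_indices (length ns))"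
proof -
  let ?A = "zq_indices (length ns)"
  define S where "S = Abs_fps (\<lambda>N. \<Sum>ms\<in>{ms \<in> ?A. hd ms \<le> N}. fps_nth (zq_term ns ms) N)"
  have "(zq_term ns has_sum S) ?A"
    unfolding has_sum_def tendsto_fps_iff
  proof
    fix N
    let ?F = "{ms \<in> ?A. hd ms \<le> N}"
    show "eventually (\<lambda>F. fps_nth (sum (zq_term ns) F) N = fps_nth S N) (finite_subsets_at_top ?A)"
      unfolding eventually_finite_subsets_at_top
    proof (intro exI[of _ ?F] conjI allI impI)
      fix Y assume Y: "finite Y \<and> ?F \<subseteq> Y \<and> Y \<subseteq> ?A"
      have "(\<Sum>ms\<in>Y. fps_nth (zq_term ns ms) N) = (\<Sum>ms\<in>?F. fps_nth (zq_term ns ms) N)"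
        using Y by (intro sum.mono_neutral_right) (auto intro!: zq_term_nth_0)
      then show "fps_nth (sum (zq_term ns) Y) N = fps_nth S N"
        by (simp add: S_def fps_sum_nth)
    qed (use finite_zq_indices_le in auto)
  qed
  then show ?thesis
    unfolding zq_def by (metis has_sum_infsum summable_on_def)
qed

end

theory Submission
  imports Defs
begin

text \<open>
  The product is determined by three facts: it commutes with \<open>y\<close> in either factor, \<open>\<one>\<close> is its unit,
  and \<open>d (v \<squnion>\<squnion> u) = dv \<squnion>\<squnion> u + v \<squnion>\<squnion> du - dv \<squnion>\<squnion> du\<close> on non-empty words, where \<open>d\<close> is invertible.
  The last identity yields, for the associator \<open>A(v, u, w)\<close>, a linear relation between its values at
  the eight corners of the cube \<open>{v, dv} \<times> {u, du} \<times> {w, dw}\<close>, each occurring with the coefficient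
  \<open>\<plusminus>1\<close> or \<open>d\<close>. Whatever the signs of the three leading exponents, a triple is the unique longest
  corner of some such cube, so \<open>A = 0\<close> by induction on the total length. The same induction, with
  squares in place of cubes, shows that words act multiplicatively as power series in an auxiliary
  variable \<open>t\<close>, on which \<open>d\<close> is \<open>F(t) \<mapsto> F(t) - F(q t)\<close>; the multiple zeta values are the values
  at \<open>t = q\<close>.
\<close>

section \<open>Linear extension\<close>

text \<open>Terms outside the support vanish because each \<open>h v\<close> is additive, so all
  sums may run over the union of the supports. The additivity of \<open>qsh\<close>,
  \<open>lin_series\<close> and \<open>zq_sh\<close> comes from here.\<close>

lemma additive_keys_sum:
  assumes "\<And>v. Modules.additive (h v)"
  shows "Modules.additive (\<lambda>x. \<Sum>v\<in>Poly_Mapping.keys x. h v (Poly_Mapping.lookup x v))"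
proof
  fix x y :: "'a \<Rightarrow>\<^sub>0 'b"
  let ?A = "Poly_Mapping.keys x \<union> Poly_Mapping.keys y"
  have *: "(\<Sum>v\<in>Poly_Mapping.keys z. h v (Poly_Mapping.lookup z v))
      = (\<Sum>v\<in>?A. h v (Poly_Mapping.lookup z v))" if "Poly_Mapping.keys z \<subseteq> ?A" for z
    using that by (intro sum.mono_neutral_left) (auto simp: in_keys_iff Modules.additive.zero[OF assms])
  show "(\<Sum>v\<in>Poly_Mapping.keys (x + y). h v (Poly_Mapping.lookup (x + y) v))
    = (\<Sum>v\<in>Poly_Mapping.keys x. h v (Poly_Mapping.lookup x v))
    + (\<Sum>v\<in>Poly_Mapping.keys y. h v (Poly_Mapping.lookup y v))"
    unfolding *[OF Poly_Mapping.keys_add] *[OF Un_upper1] *[OF Un_upper2]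
    by (simp add: lookup_add Modules.additive.add[OF assms] sum.distrib)
qed

text \<open>Only words occurring in \<open>x\<close> are compared, so a condition on its support,
  such as the absence of the empty word, can be used. Keeping the coefficients makes additivity
  suffice in place of linearity.\<close>

lemma additive_eqI:
  assumes F: "Modules.additive F" and G: "Modules.additive G"
    and eq: "\<And>v. v \<in> Poly_Mapping.keys x \<Longrightarrow>
      F (Poly_Mapping.single v (Poly_Mapping.lookup x v)) = G (Poly_Mapping.single v (Poly_Mapping.lookup x v))"
  shows "F x = G x"
proof -
  have x: "x = (\<Sum>v\<in>Poly_Mapping.keys x. Poly_Mapping.single v (Poly_Mapping.lookup x v))"
    by (rule poly_mapping_eqI)
      (auto simp: lookup_sum lookup_single when_def sum.delta' in_keys_iff)
  have "F x = (\<Sum>v\<in>Poly_Mapping.keys x. F (Poly_Mapping.single v (Poly_Mapping.lookup x v)))"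
    by (subst x) (rule Modules.additive.sum[OF F])
  also have "\<dots> = (\<Sum>v\<in>Poly_Mapping.keys x. G (Poly_Mapping.single v (Poly_Mapping.lookup x v)))"
    by (rule sum.cong) (simp_all add: eq)
  also have "\<dots> = G x"
    by (subst (3) x) (rule Modules.additive.sum[OF G, symmetric])
  finally show ?thesis .
qed

lemma lookup_scaleW: "Poly_Mapping.lookup (scaleW c x) v = c * Poly_Mapping.lookup x v"
  by (simp add: scaleW_def Poly_Mapping.map.rep_eq when_def)

lemma scaleW_add: "scaleW c (x + y) = scaleW c x + scaleW c y"
  by (rule poly_mapping_eqI) (simp add: lookup_scaleW lookup_add algebra_simps)

lemma scaleW_diff: "scaleW c (x - y) = scaleW c x - scaleW c y"
  by (rule poly_mapping_eqI) (simp add: lookup_scaleW lookup_minus algebra_simps)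

lemma scaleW_add_left: "scaleW (c + d) x = scaleW c x + scaleW d x"
  by (rule poly_mapping_eqI) (simp add: lookup_scaleW lookup_add algebra_simps)

lemma scaleW_scaleW [simp]: "scaleW c (scaleW d x) = scaleW (c * d) x"
  by (rule poly_mapping_eqI) (simp add: lookup_scaleW)

lemma scaleW_0 [simp]: "scaleW 0 x = 0" "scaleW c 0 = 0"
  by (rule poly_mapping_eqI, simp add: lookup_scaleW)+

lemma scaleW_single [simp]: "scaleW c (Poly_Mapping.single v d) = Poly_Mapping.single v (c * d)"
  by (rule poly_mapping_eqI) (simp add: lookup_scaleW lookup_single when_def)

lemma additive_linW: "Modules.additive (linW f)"
  by standard (rule linW_add)

lemma linW_scaleW: "linW f (scaleW c x) = scaleW c (linW f x)"
  by (rule additive_eqI[of "\<lambda>x. linW f (scaleW c x)"])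
    (simp_all add: Modules.additive_def linW_add scaleW_add)

lemma linW_dcat_eq_0: "linW dcat x = 0 \<longleftrightarrow> x = 0"
  by (metis Modules.additive.zero[OF additive_linW] linW_pcat_dcat)

section \<open>Bilinearity and commutativity of the product\<close>

lemma qsh_commute: "x \<squnion>\<squnion> y = y \<squnion>\<squnion> x"
  unfolding qsh_def by (subst sum.swap) (simp add: qsh_word_commute mult.commute)

lemma additive_qsh_left: "Modules.additive (\<lambda>x. x \<squnion>\<squnion> y)"
  unfolding qsh_def
  by (rule additive_keys_sum[where h = "\<lambda>v c. \<Sum>u\<in>Poly_Mapping.keys y.
     scaleW (c * Poly_Mapping.lookup y u) (qsh_word v u)"])
    (simp add: Modules.additive_def ring_distribs scaleW_add_left sum.distrib)

lemma additive_qsh_right: "Modules.additive (\<lambda>y. x \<squnion>\<squnion> y)"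
  using additive_qsh_left by (simp add: qsh_commute[of x])

lemmas qsh_add_left = Modules.additive.add[OF additive_qsh_left]
lemmas qsh_add_right = Modules.additive.add[OF additive_qsh_right]
lemmas qsh_diff_left = Modules.additive.diff[OF additive_qsh_left]
lemmas qsh_diff_right = Modules.additive.diff[OF additive_qsh_right]

lemma qsh_single:
  "Poly_Mapping.single v c \<squnion>\<squnion> Poly_Mapping.single u d = scaleW (c * d) (qsh_word v u)"
  by (auto simp: qsh_def)

lemma qsh_scaleW_left: "scaleW c x \<squnion>\<squnion> y = scaleW c (x \<squnion>\<squnion> y)"
proof (rule additive_eqI[of "\<lambda>x. scaleW c x \<squnion>\<squnion> y"])
  fix v
  let ?s = "Poly_Mapping.single v (Poly_Mapping.lookup x v)"
  show "scaleW c ?s \<squnion>\<squnion> y = scaleW c (?s \<squnion>\<squnion> y)"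
    by (rule additive_eqI[of "\<lambda>y. scaleW c ?s \<squnion>\<squnion> y"])
      (simp_all add: qsh_single mult.assoc Modules.additive_def qsh_add_right scaleW_add)
qed (simp_all add: Modules.additive_def qsh_add_left scaleW_add)

lemma qsh_scaleW_right: "x \<squnion>\<squnion> scaleW c y = scaleW c (x \<squnion>\<squnion> y)"
  using qsh_scaleW_left[of c y x] by (simp add: qsh_commute)

lemma single_eq_scaleW: "Poly_Mapping.single v c = scaleW c (wd v)"
  by simp

lemma qsh_ycat_left: "linW ycat x \<squnion>\<squnion> y = linW ycat (x \<squnion>\<squnion> y)"
proof (rule additive_eqI[of "\<lambda>x. linW ycat x \<squnion>\<squnion> y"])
  fix v
  let ?s = "Poly_Mapping.single v (Poly_Mapping.lookup x v)"
  show "linW ycat ?s \<squnion>\<squnion> y = linW ycat (?s \<squnion>\<squnion> y)"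
    by (rule additive_eqI[of "\<lambda>y. linW ycat ?s \<squnion>\<squnion> y"])
      (simp_all add: qsh_single linW_scaleW qsh_word_y_left Modules.additive_def qsh_add_right
        linW_add)
qed (simp_all add: Modules.additive_def qsh_add_left linW_add)

lemma qsh_ycat_right: "x \<squnion>\<squnion> linW ycat y = linW ycat (x \<squnion>\<squnion> y)"
  using qsh_ycat_left[of y x] by (simp add: qsh_commute)

lemma qsh_wd_Nil_left: "wd [] \<squnion>\<squnion> x = x"
proof (rule additive_eqI[OF additive_qsh_right])
  show "Modules.additive (\<lambda>x::qwords. x)"
    by standard simp
qed (simp add: qsh_single)

lemma qsh_wd_Nil_right: "x \<squnion>\<squnion> wd [] = x"
  using qsh_wd_Nil_left by (simp add: qsh_commute)

lemma Nil_in_keys_linW: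
  "[] \<in> Poly_Mapping.keys (linW f x) \<Longrightarrow> \<exists>v\<in>Poly_Mapping.keys x. f v = []"
  unfolding linW_def
  by (rule ccontr) (auto simp: in_keys_iff lookup_sum lookup_single when_def)

lemma Nil_notin_keys_add:
  assumes "[] \<notin> Poly_Mapping.keys (x :: qwords)" "[] \<notin> Poly_Mapping.keys y"
  shows "[] \<notin> Poly_Mapping.keys (x + y)" "[] \<notin> Poly_Mapping.keys (x - y)"
  using assms by (auto simp: in_keys_iff lookup_add lookup_minus)

lemma pcat_eq_Nil [simp]: "pcat v = [] \<longleftrightarrow> v = []"
  by (cases v) auto

text \<open>\<open>dcat\<close> has a junk value at \<open>[]\<close>, and the product rule for
  \<open>d\<close> fails there. Control of the support allows that rule to be applied when a factor
  is itself a product.\<close>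

lemma Nil_notin_keys_qsh_word:
  "v \<noteq> [] \<or> u \<noteq> [] \<Longrightarrow> [] \<notin> Poly_Mapping.keys (qsh_word v u)"
proof (induction v u rule: qsh_word.induct)
  case (3 a v b u)
  have y: "[] \<notin> Poly_Mapping.keys (linW ycat x)" for x
    using Nil_in_keys_linW[of ycat x] by (auto simp: ycat_def)
  have p: "[] \<notin> Poly_Mapping.keys x \<Longrightarrow> [] \<notin> Poly_Mapping.keys (linW pcat x)" for x
    using Nil_in_keys_linW[of pcat x] by auto
  have d: "[] \<notin> Poly_Mapping.keys x \<Longrightarrow> [] \<notin> Poly_Mapping.keys (linW dcat x)" for x
    using Nil_in_keys_linW[of dcat x] by auto
  show ?case
    using 3 by (subst qsh_word.simps(3)) (auto simp: y p d Nil_notin_keys_add)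
qed auto

section \<open>Associativity\<close>

text \<open>The map \<open>x \<mapsto> x - d x\<close> is multiplicative; on series in \<open>t\<close> it is the substitution of \<open>q t\<close> for \<open>t\<close>.\<close>

lemma dcat_qsh_word:
  assumes "v \<noteq> []" "u \<noteq> []"
  shows "linW dcat (qsh_word v u) =
    qsh_word (dcat v) u + qsh_word v (dcat u) - qsh_word (dcat v) (dcat u)"
  using qsh_word_dd[OF assms] by simp

lemma dcat_qsh_wd:
  assumes "[] \<notin> Poly_Mapping.keys x" "w \<noteq> []"
  shows "linW dcat (x \<squnion>\<squnion> wd w) =
    linW dcat x \<squnion>\<squnion> wd w + x \<squnion>\<squnion> wd (dcat w) - linW dcat x \<squnion>\<squnion> wd (dcat w)"
proof (rule additive_eqI[of "\<lambda>x. linW dcat (x \<squnion>\<squnion> wd w)"])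
  fix v assume "v \<in> Poly_Mapping.keys x"
  then have "v \<noteq> []" using assms by auto
  then show "linW dcat (Poly_Mapping.single v (Poly_Mapping.lookup x v) \<squnion>\<squnion> wd w) =
    linW dcat (Poly_Mapping.single v (Poly_Mapping.lookup x v)) \<squnion>\<squnion> wd w
    + Poly_Mapping.single v (Poly_Mapping.lookup x v) \<squnion>\<squnion> wd (dcat w)
    - linW dcat (Poly_Mapping.single v (Poly_Mapping.lookup x v)) \<squnion>\<squnion> wd (dcat w)"
    using assms by (simp add: qsh_single linW_scaleW dcat_qsh_word scaleW_add scaleW_diff)
qed (simp_all add: Modules.additive_def linW_add qsh_add_left)

definition associator :: "qword \<Rightarrow> qword \<Rightarrow> qword \<Rightarrow> qwords" where
  "associator v u w = qsh_word v u \<squnion>\<squnion> wd w - wd v \<squnion>\<squnion> qsh_word u w"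

text \<open>With \<open>s = id - d\<close>, both bracketings of a triple product satisfy
  \<open>s (v u w) = (s v) (s u) (s w)\<close>. Expanding in \<open>d\<close> gives, for both, the
  same alternating sum over the non-empty sets of factors hit by \<open>d\<close>; subtract.\<close>

lemma dcat_associator:
  assumes "v \<noteq> []" "u \<noteq> []" "w \<noteq> []"
  shows "linW dcat (associator v u w) =
    associator (dcat v) u w + associator v (dcat u) w + associator v u (dcat w)
    - associator (dcat v) (dcat u) w - associator (dcat v) u (dcat w) - associator v (dcat u) (dcat w)
    + associator (dcat v) (dcat u) (dcat w)"
proof -
  have l: "linW dcat (qsh_word v u \<squnion>\<squnion> wd w) = linW dcat (qsh_word v u) \<squnion>\<squnion> wd w
     + qsh_word v u \<squnion>\<squnion> wd (dcat w) - linW dcat (qsh_word v u) \<squnion>\<squnion> wd (dcat w)"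
    using assms by (intro dcat_qsh_wd Nil_notin_keys_qsh_word) auto
  have "linW dcat (qsh_word u w \<squnion>\<squnion> wd v) = linW dcat (qsh_word u w) \<squnion>\<squnion> wd v
     + qsh_word u w \<squnion>\<squnion> wd (dcat v) - linW dcat (qsh_word u w) \<squnion>\<squnion> wd (dcat v)"
    using assms by (intro dcat_qsh_wd Nil_notin_keys_qsh_word) auto
  then have r: "linW dcat (wd v \<squnion>\<squnion> qsh_word u w) = wd v \<squnion>\<squnion> linW dcat (qsh_word u w)
     + wd (dcat v) \<squnion>\<squnion> qsh_word u w - wd (dcat v) \<squnion>\<squnion> linW dcat (qsh_word u w)"
    by (simp add: qsh_commute)
  show ?thesis
    unfolding associator_def linW_diff l r dcat_qsh_word[OF assms(1,2)] dcat_qsh_word[OF assms(2,3)]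
      qsh_add_left qsh_add_right qsh_diff_left qsh_diff_right
    by (simp only: algebra_simps)
qed

lemma associator_cube:
  assumes "v \<noteq> []" "u \<noteq> []" "w \<noteq> []"
    and "v' = dcat v \<or> v = dcat v'" "u' = dcat u \<or> u = dcat u'" "w' = dcat w \<or> w = dcat w'"
    and "associator v' u w = 0" "associator v u' w = 0" "associator v u w' = 0"
    and "associator v' u' w = 0" "associator v' u w' = 0" "associator v u' w' = 0"
    and "associator v' u' w' = 0"
  shows "associator v u w = 0"
proof -
  \<comment> \<open>\<open>v0\<close> is the member of the pair \<open>v\<close>, \<open>v'\<close>
    to which \<open>d\<close> is applied, so that the relation at \<open>v0\<close>,
    \<open>u0\<close>, \<open>w0\<close> involves exactly the eight given corners.\<close>
  obtain v0 where v0: "v0 = v \<and> v' = dcat v0 \<or> v = dcat v0 \<and> v0 = v'"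
    using assms(4) by blast
  obtain u0 where u0: "u0 = u \<and> u' = dcat u0 \<or> u = dcat u0 \<and> u0 = u'"
    using assms(5) by blast
  obtain w0 where w0: "w0 = w \<and> w' = dcat w0 \<or> w = dcat w0 \<and> w0 = w'"
    using assms(6) by blast
  have "v0 \<noteq> []" "u0 \<noteq> []" "w0 \<noteq> []"
    using assms(1-3) v0 u0 w0 by auto
  \<comment> \<open>Of the eight cases, only \<open>v0 = v\<close>, \<open>u0 = u\<close>,
    \<open>w0 = w\<close> puts the wanted associator under \<open>d\<close>, where injectivity of
    \<open>d\<close> is used; in the others it stands alone up to sign.\<close>
  from dcat_associator[OF this] v0 u0 w0 assms(7-13) show ?thesis
    by (elim disjE conjE; simp add: Modules.additive.zero[OF additive_linW] linW_dcat_eq_0)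
qed

lemma associator_ycat:
  "associator (ycat v) u w = linW ycat (associator v u w)"
  "associator v (ycat u) w = linW ycat (associator v u w)"
  "associator v u (ycat w) = linW ycat (associator v u w)"
proof -
  have wd: "wd (ycat x) = linW ycat (wd x)" for x by simp
  show "associator (ycat v) u w = linW ycat (associator v u w)"
    "associator v (ycat u) w = linW ycat (associator v u w)"
    "associator v u (ycat w) = linW ycat (associator v u w)"
    unfolding associator_def wd qsh_word_y_left qsh_word_y_right qsh_ycat_left qsh_ycat_right
      linW_diff by simp_all
qed

lemma associator_Nil:
  "associator [] u w = 0" "associator v [] w = 0" "associator v u [] = 0"
  by (simp_all add: associator_def qsh_wd_Nil_left qsh_wd_Nil_right qsh_word_Nil_right)

text \<open>
  \<open>dstep\<close> moves the first exponent one step towards zero: it is \<open>dcat\<close> for a positive and \<open>pcat\<close>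
  for a negative exponent.
\<close>

fun dstep :: "qword \<Rightarrow> qword" where
  "dstep [] = []"
| "dstep (n # v) = (n - sgn n) # v"

lemma dstep_cases:
  assumes "v \<noteq> []" "hd v \<noteq> 0"
  shows "dstep v = dcat v \<or> v = dcat (dstep v)"
  using assms by (cases v) (auto simp: sgn_if)

lemma qword_length_dstep:
  assumes "v \<noteq> []" "hd v \<noteq> 0"
  shows "qword_length (dstep v) < qword_length v"
  using assms by (cases v) (auto simp: qword_length_def sgn_if)

lemma qword_length_ycat: "qword_length v < qword_length (ycat v)"
  by (simp add: qword_length_def ycat_def)

lemma ycatE:
  assumes "v \<noteq> []" "hd v = 0"
  obtains v' where "v = ycat v'"
  using assms by (cases v) (auto simp: ycat_def)

lemma associator_eq_0: "associator v u w = 0"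
proof (induction "qword_length v + qword_length u + qword_length w" arbitrary: v u w
    rule: less_induct)
  case less
  have y0: "linW ycat 0 = 0" by (rule Modules.additive.zero[OF additive_linW])
  show ?case
  proof (cases "v = [] \<or> u = [] \<or> w = []")
    case True
    then show ?thesis by (auto simp: associator_Nil)
  next
    case False
    then have ne: "v \<noteq> []" "u \<noteq> []" "w \<noteq> []" by auto
    show ?thesis
    proof (cases "hd v = 0 \<or> hd u = 0 \<or> hd w = 0")
      case True
      then consider v' where "v = ycat v'" | u' where "u = ycat u'" | w' where "w = ycat w'"
        using ne by (metis ycatE)
      then show ?thesis
        by cases (simp_all add: associator_ycat less qword_length_ycat y0)
    next
      case False
      then have hd: "hd v \<noteq> 0" "hd u \<noteq> 0" "hd w \<noteq> 0" by auto
      note len = qword_length_dstep[OF ne(1) hd(1)] qword_length_dstep[OF ne(2) hd(2)]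
        qword_length_dstep[OF ne(3) hd(3)]
      show ?thesis
        by (rule associator_cube[OF ne dstep_cases[OF ne(1) hd(1)] dstep_cases[OF ne(2) hd(2)]
              dstep_cases[OF ne(3) hd(3)]]; rule less) (use len in linarith)+
    qed
  qed
qed

lemma qsh_assoc: "(x \<squnion>\<squnion> y) \<squnion>\<squnion> z = x \<squnion>\<squnion> (y \<squnion>\<squnion> z)"
proof (rule additive_eqI[of "\<lambda>x. (x \<squnion>\<squnion> y) \<squnion>\<squnion> z"])
  fix v
  let ?v = "Poly_Mapping.single v (Poly_Mapping.lookup x v)"
  show "(?v \<squnion>\<squnion> y) \<squnion>\<squnion> z = ?v \<squnion>\<squnion> (y \<squnion>\<squnion> z)"
  proof (rule additive_eqI[of "\<lambda>y. (?v \<squnion>\<squnion> y) \<squnion>\<squnion> z"])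
    fix u
    let ?u = "Poly_Mapping.single u (Poly_Mapping.lookup y u)"
    show "(?v \<squnion>\<squnion> ?u) \<squnion>\<squnion> z = ?v \<squnion>\<squnion> (?u \<squnion>\<squnion> z)"
    proof (rule additive_eqI[of "\<lambda>z. (?v \<squnion>\<squnion> ?u) \<squnion>\<squnion> z"])
      fix w
      have "qsh_word v u \<squnion>\<squnion> wd w = wd v \<squnion>\<squnion> qsh_word u w"
        using associator_eq_0[of v u w] by (simp add: associator_def)
      then show "(?v \<squnion>\<squnion> ?u) \<squnion>\<squnion> Poly_Mapping.single w (Poly_Mapping.lookup z w) =
          ?v \<squnion>\<squnion> (?u \<squnion>\<squnion> Poly_Mapping.single w (Poly_Mapping.lookup z w))"
        \<comment> \<open>Restricting the coefficient to the form \<open>lookup _ _\<close> keeps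
          the unfolding from rewriting \<open>wd w\<close>, itself a \<open>single\<close>, over and
          over.\<close>
        unfolding single_eq_scaleW[of _ "Poly_Mapping.lookup _ _"]
        by (simp only: qsh_scaleW_left qsh_scaleW_right scaleW_scaleW qsh_wd mult_ac)
    qed (simp_all add: Modules.additive_def qsh_add_right)
  qed (simp_all add: Modules.additive_def qsh_add_left qsh_add_right)
qed (simp_all add: Modules.additive_def qsh_add_left)

section \<open>The series of a word\<close>

text \<open>
  The outer variable of \<open>rat fps fps\<close> is \<open>t\<close> and the inner one is \<open>q\<close>. The series of a word is
  its multiple zeta value with \<open>t\<close> in place of \<open>q\<close> in the numerator \<open>q\<^bsup>m\<^sub>1\<^esup>\<close>.
\<close>

primrec word_coeff :: "qword \<Rightarrow> nat \<Rightarrow> rat fps" where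
  "word_coeff [] m = (if m = 0 then 1 else 0)"
| "word_coeff (n # v) m = (if m = 0 then 0
     else inverse ((1 - fps_X ^ m) powi n) * (\<Sum>j<m. word_coeff v j))"

definition word_series :: "qword \<Rightarrow> rat fps fps" where
  "word_series v = Abs_fps (word_coeff v)"

definition q_difference :: "rat fps fps \<Rightarrow> rat fps fps" where
  "q_difference F = Abs_fps (\<lambda>m. (1 - fps_X ^ m) * fps_nth F m)"

lemma q_difference_nth [simp]: "fps_nth (q_difference F) m = (1 - fps_X ^ m) * fps_nth F m"
  by (simp add: q_difference_def)

lemma word_series_nth [simp]: "fps_nth (word_series v) m = word_coeff v m"
  by (simp add: word_series_def)

text \<open>Substituting \<open>q t\<close> for \<open>t\<close> is multiplicative because
  \<open>q^m = q^i q^(m-i)\<close>. The result is the rule that \<open>d\<close> obeys on products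
  of words.\<close>

lemma q_difference_mult:
  "q_difference (F * G) = q_difference F * G + F * q_difference G - q_difference F * q_difference G"
proof (rule fps_ext)
  fix m
  have "(1 - fps_X ^ m) * (a * b) = (1 - fps_X ^ i) * a * b + a * ((1 - fps_X ^ (m - i)) * b)
      - (1 - fps_X ^ i) * a * ((1 - fps_X ^ (m - i)) * b)" if "i \<le> m" for i and a b :: "rat fps"
  proof -
    have "(fps_X :: rat fps) ^ m = fps_X ^ i * fps_X ^ (m - i)"
      using that by (simp flip: power_add)
    then show ?thesis by (simp add: algebra_simps)
  qed
  then show "fps_nth (q_difference (F * G)) m = fps_nth
      (q_difference F * G + F * q_difference G - q_difference F * q_difference G) m"
    by (simp add: fps_mult_nth sum_distrib_left flip: sum.distrib sum_subtractf)
qed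

lemma additive_q_difference: "Modules.additive q_difference"
  by standard (simp add: fps_eq_iff algebra_simps)

text \<open>Since \<open>1 - q^m\<close> is non-zero for \<open>m > 0\<close>, the kernel consists
  of the constants in \<open>t\<close>. The condition on the constant term stands in for the
  invertibility of \<open>d\<close>.\<close>

lemma q_difference_eq_0:
  assumes "q_difference F = 0" "fps_nth F 0 = 0"
  shows "F = 0"
proof (rule fps_ext)
  fix m
  show "fps_nth F m = fps_nth 0 m"
  proof (cases "m = 0")
    case False
    then have "fps_nth (1 - fps_X ^ m :: rat fps) 0 = 1" by simp
    then have "(1 - fps_X ^ m :: rat fps) \<noteq> 0" by (metis fps_zero_nth zero_neq_one)
    moreover have "(1 - fps_X ^ m) * fps_nth F m = 0"
      using assms(1) by (metis q_difference_nth fps_zero_nth)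
    ultimately show ?thesis by simp
  qed (use assms in simp)
qed

text \<open>The non-zero constant term makes \<open>inverse a\<close> a true inverse. The case split
  keeps \<open>n\<close> and \<open>n - 1\<close> on the same side of zero, where
  \<open>powi\<close> is an ordinary power of \<open>a\<close> or of
  \<open>inverse a\<close>.\<close>

lemma inverse_powi_diff_1:
  fixes a :: "'a::field fps"
  assumes "fps_nth a 0 \<noteq> 0"
  shows "inverse (a powi (n - 1)) = a * inverse (a powi n)"
proof -
  have inv: "a * inverse a = 1" "inverse (inverse a) = a"
    using assms by (auto simp: inverse_mult_eq_1' fps_inverse_idempotent)
  consider "n \<ge> 1" | "n \<le> 0" by linarith
  then show ?thesis
  proof cases
    case 1
    then obtain k where "n = int (Suc k)" by (metis nonneg_int_cases Suc_as_int add.commute diff_add_cancel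
        diff_ge_0_iff_ge of_nat_Suc)
    then show ?thesis by (simp add: power_int_def fps_inverse_mult nat_add_distrib inv flip: mult.assoc)
  next
    case 2
    then obtain k where "n = - int k" by (metis nonpos_int_cases)
    then have *: "n - 1 = - int (Suc k)" by simp
    have powi: "inverse (a powi (- int j)) = a ^ j" for j
      by (cases "j = 0") (simp_all add: power_int_def fps_inverse_power inv)
    show ?thesis unfolding * powi using \<open>n = - int k\<close> powi[of k] by simp
  qed
qed

text \<open>Lowering the first exponent multiplies the coefficient of \<open>t^m\<close> by
  \<open>1 - q^m\<close>. The empty word is excluded: \<open>dcat [] = []\<close>, whereas the
  series \<open>1\<close> has \<open>q\<close>-difference zero.\<close>

lemma word_series_dcat: "v \<noteq> [] \<Longrightarrow> word_series (dcat v) = q_difference (word_series v)"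
  by (cases v) (auto simp: fps_eq_iff inverse_powi_diff_1 mult.assoc)

text \<open>This is \<open>t / (1 - t)\<close>. Multiplication by it sums the coefficients of
  strictly smaller index, which encodes the strict inequality between consecutive summation
  indices.\<close>

definition y_series :: "rat fps fps" where
  "y_series = Abs_fps (\<lambda>m. if m = 0 then 0 else 1)"

lemma word_series_ycat: "word_series (ycat v) = y_series * word_series v"
proof (rule fps_ext)
  fix m
  have "fps_nth (word_series v * y_series) m = (\<Sum>i\<in>{0..m}. if i < m then word_coeff v i else 0)"
    unfolding fps_mult_nth by (intro sum.cong) (auto simp: y_series_def)
  also have "\<dots> = (\<Sum>i<m. word_coeff v i)"
    by (intro sum.mono_neutral_cong_right) auto
  finally show "fps_nth (word_series (ycat v)) m = fps_nth (y_series * word_series v) m"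
    by (simp add: ycat_def mult.commute)
qed

lemma word_series_Nil: "word_series [] = 1"
  by (simp add: fps_eq_iff)

definition lin_series :: "qwords \<Rightarrow> rat fps fps" where
  "lin_series x = (\<Sum>v\<in>Poly_Mapping.keys x.
     fps_const (fps_const (Poly_Mapping.lookup x v)) * word_series v)"

lemma additive_lin_series: "Modules.additive lin_series"
  unfolding lin_series_def[abs_def]
  by (rule additive_keys_sum[where h = "\<lambda>v c. fps_const (fps_const c) * word_series v"])
    (simp add: Modules.additive_def algebra_simps flip: fps_const_add)

lemmas lin_series_add = Modules.additive.add[OF additive_lin_series]

lemma lin_series_single:
  "lin_series (Poly_Mapping.single v c) = fps_const (fps_const c) * word_series v"
  by (auto simp: lin_series_def)

lemma lin_series_ycat: "lin_series (linW ycat x) = y_series * lin_series x"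
  by (rule additive_eqI[of "\<lambda>x. lin_series (linW ycat x)"])
    (simp_all add: lin_series_single word_series_ycat mult_ac Modules.additive_def linW_add
      lin_series_add distrib_left)

lemma lin_series_dcat:
  assumes "[] \<notin> Poly_Mapping.keys x"
  shows "lin_series (linW dcat x) = q_difference (lin_series x)"
proof (rule additive_eqI[of "\<lambda>x. lin_series (linW dcat x)"])
  fix v assume "v \<in> Poly_Mapping.keys x"
  with assms have "v \<noteq> []" by auto
  moreover have "q_difference (fps_const c * F) = fps_const c * q_difference F" for c F
    by (simp add: fps_eq_iff mult_ac)
  ultimately show "lin_series (linW dcat (Poly_Mapping.single v (Poly_Mapping.lookup x v))) =
      q_difference (lin_series (Poly_Mapping.single v (Poly_Mapping.lookup x v)))"
    by (simp add: lin_series_single word_series_dcat)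
qed (simp_all add: Modules.additive_def lin_series_add linW_add
    Modules.additive.add[OF additive_q_difference])

lemma lin_series_nth_0:
  assumes "[] \<notin> Poly_Mapping.keys x"
  shows "fps_nth (lin_series x) 0 = 0"
proof -
  have "word_coeff v 0 = 0" if "v \<in> Poly_Mapping.keys x" for v
    using that assms by (cases v) auto
  then show ?thesis by (simp add: lin_series_def fps_sum_nth)
qed

section \<open>Multiplicativity of the series of words\<close>

definition defect :: "qword \<Rightarrow> qword \<Rightarrow> rat fps fps" where
  "defect v u = word_series v * word_series u - lin_series (qsh_word v u)"

text \<open>Products of series under \<open>q_difference\<close> and products of words under
  \<open>d\<close> obey the same rule, so their difference obeys it too.\<close>

lemma q_difference_defect:
  assumes "v \<noteq> []" "u \<noteq> []"
  shows "q_difference (defect v u) = defect (dcat v) u + defect v (dcat u) - defect (dcat v) (dcat u)"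
proof -
  have "q_difference (lin_series (qsh_word v u)) = lin_series (linW dcat (qsh_word v u))"
    using assms by (intro lin_series_dcat[symmetric] Nil_notin_keys_qsh_word) auto
  then show ?thesis
    using assms
    by (simp add: defect_def Modules.additive.diff[OF additive_q_difference] q_difference_mult
        word_series_dcat dcat_qsh_word Modules.additive.diff[OF additive_lin_series]
        lin_series_add)
qed

lemma defect_nth_0:
  assumes "v \<noteq> []" "u \<noteq> []"
  shows "fps_nth (defect v u) 0 = 0"
proof -
  have "word_coeff v 0 = 0" using assms by (cases v) auto
  moreover have "fps_nth (lin_series (qsh_word v u)) 0 = 0"
    using assms by (intro lin_series_nth_0 Nil_notin_keys_qsh_word) auto
  ultimately show ?thesis by (simp add: defect_def)
qed

lemma defect_square:
  assumes "v \<noteq> []" "u \<noteq> []" and "v' = dcat v \<or> v = dcat v'" "u' = dcat u \<or> u = dcat u'"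
    and "defect v' u = 0" "defect v u' = 0" "defect v' u' = 0"
  shows "defect v u = 0"
proof -
  obtain v0 where v0: "v0 = v \<and> v' = dcat v0 \<or> v = dcat v0 \<and> v0 = v'"
    using assms(3) by blast
  obtain u0 where u0: "u0 = u \<and> u' = dcat u0 \<or> u = dcat u0 \<and> u0 = u'"
    using assms(4) by blast
  have "v0 \<noteq> []" "u0 \<noteq> []"
    using assms(1,2) v0 u0 by auto
  \<comment> \<open>The operator is not injective, but for non-empty words the defect has no
    constant term and thus meets its kernel only in zero.\<close>
  have inj: "q_difference (defect v u) = 0 \<longleftrightarrow> defect v u = 0"
    using q_difference_eq_0 defect_nth_0[OF assms(1,2)] Modules.additive.zero[OF additive_q_difference]
    by metis
  from q_difference_defect[OF \<open>v0 \<noteq> []\<close> \<open>u0 \<noteq> []\<close>] v0 u0 assms(5-7) show ?thesis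
    by (elim disjE conjE; simp add: Modules.additive.zero[OF additive_q_difference] inj)
qed

lemma defect_ycat:
  "defect (ycat v) u = y_series * defect v u" "defect v (ycat u) = y_series * defect v u"
  by (simp_all add: defect_def word_series_ycat qsh_word_y_left qsh_word_y_right lin_series_ycat
      algebra_simps)

lemma defect_eq_0: "defect v u = 0"
proof (induction "qword_length v + qword_length u" arbitrary: v u rule: less_induct)
  case less
  show ?case
  proof (cases "v = [] \<or> u = []")
    case True
    then show ?thesis
      by (auto simp: defect_def word_series_Nil qsh_word_Nil_right lin_series_single)
  next
    case False
    then have ne: "v \<noteq> []" "u \<noteq> []" by auto
    show ?thesis
    proof (cases "hd v = 0 \<or> hd u = 0")
      case True
      then consider v' where "v = ycat v'" | u' where "u = ycat u'"
        using ne by (metis ycatE)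
      then show ?thesis
        by cases (simp_all add: defect_ycat less qword_length_ycat)
    next
      case False
      then have hd: "hd v \<noteq> 0" "hd u \<noteq> 0" by auto
      note len = qword_length_dstep[OF ne(1) hd(1)] qword_length_dstep[OF ne(2) hd(2)]
      show ?thesis
        by (rule defect_square[OF ne dstep_cases[OF ne(1) hd(1)] dstep_cases[OF ne(2) hd(2)]];
            rule less) (use len in linarith)+
    qed
  qed
qed

lemma word_series_mult: "word_series v * word_series u = lin_series (qsh_word v u)"
  using defect_eq_0[of v u] by (simp add: defect_def)

section \<open>Evaluation at \<open>t = q\<close>\<close>

text \<open>The value at \<open>t = q\<close>, that is, the sum of \<open>q^m F_m(q)\<close> over
  \<open>m\<close>. Only \<open>m \<le> N\<close> contributes to the coefficient of
  \<open>q^N\<close>, so each coefficient is a finite sum.\<close>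

definition fps_diag :: "'a::comm_ring_1 fps fps \<Rightarrow> 'a fps" where
  "fps_diag F = Abs_fps (\<lambda>N. \<Sum>m\<le>N. fps_nth (fps_nth F m) (N - m))"

text \<open>Any cutoff beyond \<open>N\<close> gives the same coefficient, so two series can be
  multiplied with one common cutoff.\<close>

lemma fps_diag_nth:
  assumes "N \<le> M"
  shows "fps_nth (fps_diag F) N = fps_nth (\<Sum>m\<le>M. fps_X ^ m * fps_nth F m) N"
proof -
  have "(\<Sum>m\<le>M. fps_nth (fps_X ^ m * fps_nth F m) N) = (\<Sum>m\<le>N. fps_nth (fps_nth F m) (N - m))"
    using assms by (intro sum.mono_neutral_cong_right) (auto simp: fps_X_power_mult_nth)
  then show ?thesis by (simp add: fps_diag_def fps_sum_nth)
qed

lemma fps_diag_mult: "fps_diag (F * G) = fps_diag F * fps_diag G"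
proof (rule fps_ext)
  fix N
  let ?f = "\<lambda>(i, j). fps_X ^ (i + j) * (fps_nth F i * fps_nth G j)"
  have "fps_nth (fps_diag F * fps_diag G) N
      = fps_nth ((\<Sum>m\<le>N. fps_X ^ m * fps_nth F m) * (\<Sum>m\<le>N. fps_X ^ m * fps_nth G m)) N"
    unfolding fps_mult_nth by (intro sum.cong refl) (simp add: fps_diag_nth[of _ N])
  also have "\<dots> = (\<Sum>p\<in>{..N} \<times> {..N}. fps_nth (?f p) N)"
    by (simp add: sum_product sum.cartesian_product fps_sum_nth power_add mult_ac case_prod_unfold)
  \<comment> \<open>The factor \<open>fps_X ^ (i + j)\<close> kills the part of the square with
    \<open>i + j > N\<close>. The remaining triangle is then summed along the diagonals
    \<open>i + j = k\<close>.\<close>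
  also have "\<dots> = (\<Sum>p\<in>{(i, j). i + j \<le> N}. fps_nth (?f p) N)"
    by (intro sum.mono_neutral_right) (auto simp: fps_X_power_mult_nth split: if_splits)
  also have "\<dots> = (\<Sum>k\<le>N. \<Sum>i\<le>k. fps_nth (?f (i, k - i)) N)"
    using sum.triangle_reindex_eq[of "\<lambda>i j. fps_nth (?f (i, j)) N" N] by (simp add: case_prod_unfold)
  also have "\<dots> = fps_nth (fps_diag (F * G)) N"
    by (simp add: fps_diag_nth[of N N] fps_sum_nth fps_mult_nth[of F] sum_distrib_left atMost_atLeast0)
  finally show "fps_nth (fps_diag (F * G)) N = fps_nth (fps_diag F * fps_diag G) N" ..
qed

section \<open>Expansion of the multiple zeta values by their leading index\<close>

definition zq_weight :: "int list \<Rightarrow> nat list \<Rightarrow> rat fps" where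
  "zq_weight ns ms = inverse (\<Prod>i<length ns. (1 - fps_X ^ (ms ! i)) powi (ns ! i))"

lemma powi_nth_0:
  assumes "fps_nth a 0 \<noteq> (0 :: 'a::field)"
  shows "fps_nth (a powi n) 0 \<noteq> 0"
  using assms by (simp add: power_int_def fps_power_zeroth)

lemma prod_nth_0:
  assumes "\<And>i. i \<in> A \<Longrightarrow> fps_nth (f i) 0 \<noteq> (0 :: 'a::field)"
  shows "fps_nth (prod f A) 0 \<noteq> 0"
  using assms by (induction A rule: infinite_finite_induct) auto

text \<open>All indices are positive, so the denominator has non-zero constant term and division by
  it is multiplication by its inverse.\<close>

lemma zq_term_eq:
  assumes "ms \<in> zq_indices (length ns)"
  shows "zq_term ns ms = fps_X ^ hd ms * zq_weight ns ms"
  unfolding zq_term_def zq_weight_def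
proof (intro fps_divide_unit prod_nth_0 powi_nth_0)
  fix i assume "i \<in> {..<length ns}"
  then have "ms ! i > 0" using assms by (auto simp: zq_indices_def)
  then show "fps_nth (1 - fps_X ^ (ms ! i)) 0 \<noteq> (0::rat)" by simp
qed

lemma zq_weight_Cons:
  "zq_weight (n # ns) (m # ms) = inverse ((1 - fps_X ^ m) powi n) * zq_weight ns ms"
  by (simp add: zq_weight_def prod.lessThan_Suc_shift fps_inverse_mult del: prod.lessThan_Suc)

text \<open>The appended \<open>0\<close> makes the leading index of the empty list \<open>0\<close>.\<close>

lemma word_coeff_eq_sum:
  "word_coeff v m = (\<Sum>ms\<in>{ms \<in> zq_indices (length v). hd (ms @ [0]) = m}. zq_weight v ms)"
proof (induction v arbitrary: m)
  case Nil
  have "{ms \<in> zq_indices (length []). hd (ms @ [0]) = m} = (if m = 0 then {[]} else {})"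
    by (auto simp: zq_indices_def)
  then show ?case by (simp add: zq_weight_def)
next
  case (Cons n v)
  let ?B = "{ms \<in> zq_indices (length v). hd (ms @ [0]) < m}"
  show ?case
  proof (cases "m = 0")
    case True
    then have empty: "{ms \<in> zq_indices (length (n # v)). hd (ms @ [0]) = m} = {}"
      by (auto simp: zq_indices_def length_Suc_conv)
    show ?thesis unfolding empty using True by simp
  next
    case False
    \<comment> \<open>After removal of the head \<open>m\<close>, the rest starts below
      \<open>m\<close> or is empty; in the latter case the appended \<open>0\<close> is still below
      \<open>m\<close>, since \<open>m\<close> is non-zero.\<close>
    have eq: "{ms \<in> zq_indices (length (n # v)). hd (ms @ [0]) = m} = (#) m ` ?B"
    proof (intro set_eqI iffI)
      fix ms assume "ms \<in> {ms \<in> zq_indices (length (n # v)). hd (ms @ [0]) = m}"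
      then obtain ms' where "ms = m # ms'" "m # ms' \<in> zq_indices (Suc (length v))"
        by (cases ms) (auto simp: zq_indices_def)
      then show "ms \<in> (#) m ` ?B"
        using False by (cases ms') (auto simp: zq_indices_def)
    next
      fix ms assume "ms \<in> (#) m ` ?B"
      then obtain ms' where "ms = m # ms'" "ms' \<in> ?B" by auto
      then show "ms \<in> {ms \<in> zq_indices (length (n # v)). hd (ms @ [0]) = m}"
        using False by (cases ms') (auto simp: zq_indices_def)
    qed
    have "finite ?B"
    proof (rule finite_subset)
      show "?B \<subseteq> insert [] {ms \<in> zq_indices (length v). hd ms \<le> m}"
        by (auto simp: hd_append)
    qed (simp add: finite_zq_indices_le)
    then have "(\<Sum>j<m. \<Sum>ms\<in>{ms \<in> ?B. hd (ms @ [0]) = j}. zq_weight v ms) = (\<Sum>ms\<in>?B. zq_weight v ms)"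
      by (intro sum.group) auto
    moreover have "{ms \<in> ?B. hd (ms @ [0]) = j} = {ms \<in> zq_indices (length v). hd (ms @ [0]) = j}"
      if "j < m" for j
      using that by auto
    ultimately have "(\<Sum>j<m. word_coeff v j) = (\<Sum>ms\<in>?B. zq_weight v ms)"
      by (simp add: Cons.IH)
    then show ?thesis
      unfolding eq using False
      by (subst sum.reindex) (auto simp: zq_weight_Cons sum_distrib_left)
  qed
qed

text \<open>Convergence is coefficientwise, so the coefficient of \<open>q^N\<close> is constant on
  all finite index sets that contain a suitable \<open>X\<close>.\<close>

lemma zq_nth:
  "fps_nth (zq ns) N =
    (\<Sum>ms\<in>{ms \<in> zq_indices (length ns). hd ms \<le> N}. fps_nth (zq_term ns ms) N)"
proof -
  let ?A = "zq_indices (length ns)"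
  let ?F = "{ms \<in> ?A. hd ms \<le> N}"
  have "eventually (\<lambda>F. fps_nth (sum (zq_term ns) F) N = fps_nth (zq ns) N) (finite_subsets_at_top ?A)"
    using zq_has_sum[of ns] unfolding has_sum_def tendsto_fps_iff by blast
  then obtain X where X: "finite X" "X \<subseteq> ?A"
    "\<forall>Y. finite Y \<and> X \<subseteq> Y \<and> Y \<subseteq> ?A \<longrightarrow> fps_nth (sum (zq_term ns) Y) N = fps_nth (zq ns) N"
    unfolding eventually_finite_subsets_at_top by (elim exE conjE)
  have "finite (X \<union> ?F) \<and> X \<subseteq> X \<union> ?F \<and> X \<union> ?F \<subseteq> ?A"
    using X(1,2) finite_zq_indices_le by auto
  \<comment> \<open>Enlarging \<open>X\<close> by \<open>?F\<close> keeps the stable value. The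
    members of \<open>X\<close> outside \<open>?F\<close> have leading index above \<open>N\<close>
    and contribute nothing.\<close>
  then have "fps_nth (zq ns) N = fps_nth (sum (zq_term ns) (X \<union> ?F)) N"
    by (rule X(3)[rule_format, of "X \<union> ?F", symmetric])
  also have "\<dots> = (\<Sum>ms\<in>?F. fps_nth (zq_term ns ms) N)"
    unfolding fps_sum_nth using X(1,2) finite_zq_indices_le
    by (intro sum.mono_neutral_right) (auto intro!: zq_term_nth_0)
  finally show ?thesis .
qed

text \<open>Group the index lists by their leading entry \<open>m\<close>: at \<open>t = q\<close>
  the monomial \<open>t^m\<close> becomes the numerator \<open>q^m\<close> shared by all terms of
  the group.\<close>

lemma zq_word_eq: "zq_word v = fps_diag (word_series v)"
proof (cases "v = []")
  case True
  then show ?thesis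
    by (auto simp: zq_word_def fps_eq_iff fps_diag_def if_distrib[of "\<lambda>f. fps_nth f _"] cong: if_cong)
next
  case False
  show ?thesis
  proof (rule fps_ext)
    fix N
    let ?F = "{ms \<in> zq_indices (length v). hd ms \<le> N}"
    have hd: "hd (ms @ [0]) = hd ms" if "ms \<in> zq_indices (length v)" for ms
      using that False by (cases ms) (auto simp: zq_indices_def)
    have "fps_nth (fps_diag (word_series v)) N
        = (\<Sum>m\<le>N. \<Sum>ms\<in>{ms \<in> ?F. hd ms = m}. fps_nth (zq_term v ms) N)"
      unfolding fps_diag_nth[OF order_refl] fps_sum_nth word_series_nth word_coeff_eq_sum
        sum_distrib_left
      by (intro sum.cong) (auto simp: hd zq_term_eq)
    also have "\<dots> = (\<Sum>ms\<in>?F. fps_nth (zq_term v ms) N)"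
      by (intro sum.group finite_zq_indices_le) auto
    finally show "fps_nth (zq_word v) N = fps_nth (fps_diag (word_series v)) N"
      using False by (simp add: zq_word_def zq_nth)
  qed
qed

lemma additive_fps_diag: "Modules.additive fps_diag"
  by standard (simp add: fps_eq_iff fps_diag_def sum.distrib)

lemma zq_sh_eq: "zq_sh x = fps_diag (lin_series x)"
proof (rule additive_eqI[of zq_sh])
  show "Modules.additive zq_sh"
    unfolding zq_sh_def[abs_def]
    by (rule additive_keys_sum[where h = "\<lambda>v c. fps_const c * zq_word v"])
      (simp add: Modules.additive_def algebra_simps flip: fps_const_add)
  show "Modules.additive (\<lambda>x. fps_diag (lin_series x))"
    by (simp add: Modules.additive_def lin_series_add Modules.additive.add[OF additive_fps_diag])
  fix v
  have "fps_diag (fps_const (fps_const c) * F) = fps_const c * fps_diag F" for c :: rat and F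
    by (simp add: fps_eq_iff fps_diag_def sum_distrib_left)
  then show "zq_sh (Poly_Mapping.single v (Poly_Mapping.lookup x v)) =
      fps_diag (lin_series (Poly_Mapping.single v (Poly_Mapping.lookup x v)))"
    by (auto simp: lin_series_single zq_sh_def zq_word_eq)
qed

theorem theorem7:
  shows "(\<forall>x y. x \<squnion>\<squnion> y = y \<squnion>\<squnion> x) \<and>
    (\<forall>x y z. (x \<squnion>\<squnion> y) \<squnion>\<squnion> z = x \<squnion>\<squnion> (y \<squnion>\<squnion> z)) \<and>
    (\<forall>v u. zq_sh (wd v) * zq_sh (wd u) = zq_sh (wd v \<squnion>\<squnion> wd u))"
  using qsh_commute qsh_assoc
  by (auto simp: zq_sh_eq lin_series_single word_series_mult simp flip: fps_diag_mult)

end
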